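(* Let $X$ be a pseudo-metric space. If $X$ is precompact and its entropic dimension satisfies $\delta(X)=0$, then $\omega(X,\mathrm{Aut}_L(X))=1$, where $\omega$ denotes the asymptotic uniform complexity, and hence $(X,\mathrm{Aut}_L(X))$ is amenable.
   Context: A pseudo-metric space is a non-empty set $X$ with a map $d\colon X\times X\to[0,\infty)$ with $d(x,x)=0$, $d(x,y)=d(y,x)$, $d(x,z)\leq d(x,y)+d(y,z)$. $B(x,r)=\{y\in X\mid d(x,y)<r\}$. For $\mathcal{U},\mathcal{V}\subseteq\mathcal{P}(X)$ (power set), write $\mathcal{U}\preceq\mathcal{V}$ ("$\mathcal{V}$ refines $\mathcal{U}$") if every $V\in\mathcal{V}$ is contained in some $U\in\mathcal{U}$; $\mathcal{U}\vee\mathcal{V}=\{U\cap V\mid U\in\mathcal{U},V\in\mathcal{V}\}$. A pseudo-metric space $X$ is regarded as a uniform space whose uniform coverings are exactly those $\mathcal{U}\subseteq\mathcal{P}(X)$ for which there is $r>0$ with $\mathcal{U}\preceq\{B(x,r)\mid x\in X\}$. $\mathcal{N}(X)$ is the set of finite uniform coverings. A map $f\colon X\to Y$ is uniformly continuous if $\{f^{-1}(U)\mid U\in\mathcal{U}\}$ is a uniform covering of $X$ for each uniform covering $\mathcal{U}$ of $Y$. $\mathcal{F}(S)$ denotes the set of finite subsets of a set $S$. $X$ is precompact if every uniform covering is refined by a finite uniform covering; equivalently, for each $r>0$ there is a finite $F\subseteq X$ with $X=\bigcup_{x\in F}B(x,r)$. In that case, for $r>0$ put $\gamma(r)=\inf\{|F|\mid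 F\in\mathcal{F}(X),\ X=\bigcup_{x\in F}B(x,r)\}$, and the entropic dimension of $X$ is $\delta(X)=\limsup_{r\to0}\,-\frac{\log_2(\gamma(r))}{\log_2(r)}$ ($r\to 0$ through positive reals). $\mathrm{Aut}_L(X)$ is the group of all bijections $f\colon X\to X$ such that both $f$ and $f^{-1}$ are Lipschitz-continuous ($f$ is Lipschitz-continuous if there is $c\in[0,\infty)$ with $d(f(x),f(y))\leq c\,d(x,y)$ for all $x,y$). It is a subgroup of the group of uniform automorphisms of $X$. For $\mathcal{U}\in\mathcal{N}(X)$, $N(\mathcal{U})=\inf\{|\mathcal{V}|\mid\mathcal{V}\in\mathcal{N}(X),\ \mathcal{U}\preceq\mathcal{V}\}$. For a group $G$ of uniform automorphisms (bijections uniformly continuous in both directions) of $X$ and $g\in G$, $g(\mathcal{V})=\{g(V)\mid V\in\mathcal{V}\}$; the asymptotic uniform complexity is $$\omega(X,G)=\sup_{E\in\mathcal{F}(G)}\ \sup_{\mathcal{U}\in\mathcal{N}(X)}\ \inf\left\{\sup_{g\in E}\frac{N(\mathcal{V}\vee g(\mathcal{V}))}{N(\mathcal{V})}\ \middle|\ \mathcal{V}\in\mathcal{N}(X),\ \mathcal{U}\preceq\mathcal{V}\right\}$$ (empty suprema are taken in the extended reals; $E=\emptyset$ does not affect the value). Amenability: $UC_b(X)$ is the space of bounded uniformly continuous functions $X\to\mathbb{R}$. $(X,G)$ is amenable if there is a linear map $m\colon UC_b(X)\to\mathbb{R}$ with $\inf_{x\in X} f(x)\leq m(f)\leq\sup_{x\in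 X} f(x)$ and $m(f\circ g)=m(f)$ for all $f\in UC_b(X)$ and $g\in G$. *)

theory Defs
  imports "HOL-Analysis.Analysis" "HOL-Algebra.Bij"
begin

locale pseudo_metric_space =
  fixes X :: "'a set" and d :: "'a \<Rightarrow> 'a \<Rightarrow> real"
  assumes nonempty: "X \<noteq> {}"
    and nonneg: "x \<in> X \<Longrightarrow> y \<in> X \<Longrightarrow> 0 \<le> d x y"
    and refl_zero: "x \<in> X \<Longrightarrow> d x x = 0"
    and commute: "x \<in> X \<Longrightarrow> y \<in> X \<Longrightarrow> d x y = d y x"
    and triangle: "x \<in> X \<Longrightarrow> y \<in> X \<Longrightarrow> z \<in> X \<Longrightarrow> d x z \<le> d x y + d y z"

definition pball :: "'a set \<Rightarrow> ('a \<Rightarrow> 'a \<Rightarrow> real) \<Rightarrow> 'a \<Rightarrow> real \<Rightarrow> 'a set" where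
  "pball X d x r = {y \<in> X. d x y < r}"

text \<open>\<open>\<U> \<preceq> \<V>\<close> reads ``\<open>\<V>\<close> refines \<open>\<U>\<close>'': the finer family is on the right.\<close>

definition refined_by :: "'a set set \<Rightarrow> 'a set set \<Rightarrow> bool" (infix "\<preceq>" 50) where
  "\<U> \<preceq> \<V> \<longleftrightarrow> (\<forall>V\<in>\<V>. \<exists>U\<in>\<U>. V \<subseteq> U)"

definition cover_join :: "'a set set \<Rightarrow> 'a set set \<Rightarrow> 'a set set" where
  "cover_join \<U> \<V> = {U \<inter> V | U V. U \<in> \<U> \<and> V \<in> \<V>}"

definition uniform_covering :: "'a set \<Rightarrow> ('a \<Rightarrow> 'a \<Rightarrow> real) \<Rightarrow> 'a set set \<Rightarrow> bool" where
  "uniform_covering X d \<U> \<longleftrightarrow>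
     \<U> \<subseteq> Pow X \<and> (\<exists>r>0. \<U> \<preceq> {pball X d x r | x. x \<in> X})"

definition fin_uniform_coverings :: "'a set \<Rightarrow> ('a \<Rightarrow> 'a \<Rightarrow> real) \<Rightarrow> 'a set set set" where
  "fin_uniform_coverings X d = {\<U>. finite \<U> \<and> uniform_covering X d \<U>}"

definition uniformly_cont ::
  "'a set \<Rightarrow> ('a \<Rightarrow> 'a \<Rightarrow> real) \<Rightarrow> 'b set \<Rightarrow> ('b \<Rightarrow> 'b \<Rightarrow> real) \<Rightarrow> ('a \<Rightarrow> 'b) \<Rightarrow> bool" where
  "uniformly_cont X d Y e f \<longleftrightarrow>
     f \<in> X \<rightarrow> Y \<and>
     (\<forall>\<U>. uniform_covering Y e \<U> \<longrightarrow> uniform_covering X d {f -` U \<inter> X | U. U \<in> \<U>})"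

definition precompact :: "'a set \<Rightarrow> ('a \<Rightarrow> 'a \<Rightarrow> real) \<Rightarrow> bool" where
  "precompact X d \<longleftrightarrow>
     (\<forall>\<U>. uniform_covering X d \<U> \<longrightarrow> (\<exists>\<V>\<in>fin_uniform_coverings X d. \<U> \<preceq> \<V>))"

text \<open>The infimum is taken over natural numbers; for precompact \<open>X\<close> and \<open>r > 0\<close> it is over a
  nonempty set, hence attained.\<close>

definition covering_number :: "'a set \<Rightarrow> ('a \<Rightarrow> 'a \<Rightarrow> real) \<Rightarrow> real \<Rightarrow> nat" where
  "covering_number X d r = Inf {card F | F. F \<in> Fpow X \<and> X = (\<Union>x\<in>F. pball X d x r)}"

definition entropic_dim :: "'a set \<Rightarrow> ('a \<Rightarrow> 'a \<Rightarrow> real) \<Rightarrow> ereal" where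
  "entropic_dim X d =
     Limsup (at_right 0) (\<lambda>r::real. ereal (- (log 2 (real (covering_number X d r)) / log 2 r)))"

definition lipschitz_self :: "'a set \<Rightarrow> ('a \<Rightarrow> 'a \<Rightarrow> real) \<Rightarrow> ('a \<Rightarrow> 'a) \<Rightarrow> bool" where
  "lipschitz_self X d f \<longleftrightarrow> (\<exists>c\<ge>0. \<forall>x\<in>X. \<forall>y\<in>X. d (f x) (f y) \<le> c * d x y)"

text \<open>Self-bijections of \<open>X\<close> are elements of \<^const>\<open>Bij\<close>, i.e. extensional functions, so that
  each bijection of the carrier is represented by exactly one HOL function.\<close>

definition Aut_L :: "'a set \<Rightarrow> ('a \<Rightarrow> 'a \<Rightarrow> real) \<Rightarrow> ('a \<Rightarrow> 'a) set" where
  "Aut_L X d = {f \<in> Bij X. lipschitz_self X d f \<and> lipschitz_self X d (inv_into X f)}"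

definition uniform_auts :: "'a set \<Rightarrow> ('a \<Rightarrow> 'a \<Rightarrow> real) \<Rightarrow> ('a \<Rightarrow> 'a) set" where
  "uniform_auts X d =
     {f \<in> Bij X. uniformly_cont X d X d f \<and> uniformly_cont X d X d (inv_into X f)}"

definition cover_N :: "'a set \<Rightarrow> ('a \<Rightarrow> 'a \<Rightarrow> real) \<Rightarrow> 'a set set \<Rightarrow> nat" where
  "cover_N X d \<U> = Inf {card \<V> | \<V>. \<V> \<in> fin_uniform_coverings X d \<and> \<U> \<preceq> \<V>}"

text \<open>The values are in \<^typ>\<open>ereal\<close>, so \<open>E = {}\<close> contributes \<open>-\<infinity>\<close> to the outer supremum.\<close>

definition asym_uniform_complexity ::
  "'a set \<Rightarrow> ('a \<Rightarrow> 'a \<Rightarrow> real) \<Rightarrow> ('a \<Rightarrow> 'a) set \<Rightarrow> ereal" where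
  "asym_uniform_complexity X d G =
     (SUP E\<in>Fpow G. SUP \<U>\<in>fin_uniform_coverings X d.
        INF \<V>\<in>{\<V> \<in> fin_uniform_coverings X d. \<U> \<preceq> \<V>}.
          SUP g\<in>E. ereal (real (cover_N X d (cover_join \<V> ((`) g ` \<V>))) / real (cover_N X d \<V>)))"

definition UC_b :: "'a set \<Rightarrow> ('a \<Rightarrow> 'a \<Rightarrow> real) \<Rightarrow> ('a \<Rightarrow> real) set" where
  "UC_b X d = {f \<in> extensional X. bounded (f ` X) \<and> uniformly_cont X d UNIV dist f}"

text \<open>The first two conjuncts say that \<open>m\<close> is linear on \<^const>\<open>UC_b\<close>; vector space operations and
  composition are restricted to \<open>X\<close> because elements of \<^const>\<open>UC_b\<close> are extensional.\<close>

definition amenable :: "'a set \<Rightarrow> ('a \<Rightarrow> 'a \<Rightarrow> real) \<Rightarrow> ('a \<Rightarrow> 'a) set \<Rightarrow> bool" where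
  "amenable X d G \<longleftrightarrow>
     (\<exists>m :: ('a \<Rightarrow> real) \<Rightarrow> real.
        (\<forall>f\<in>UC_b X d. \<forall>g\<in>UC_b X d. m (\<lambda>x\<in>X. f x + g x) = m f + m g) \<and>
        (\<forall>c. \<forall>f\<in>UC_b X d. m (\<lambda>x\<in>X. c * f x) = c * m f) \<and>
        (\<forall>f\<in>UC_b X d. (INF x\<in>X. f x) \<le> m f \<and> m f \<le> (SUP x\<in>X. f x)) \<and>
        (\<forall>f\<in>UC_b X d. \<forall>g\<in>G. m (compose X f g) = m f))"

context pseudo_metric_space
begin

lemma lipschitz_imp_uniformly_cont:
  assumes f: "f \<in> X \<rightarrow> X" and L: "lipschitz_self X d f"
  shows "uniformly_cont X d X d f"
  unfolding uniformly_cont_def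
proof (intro conjI allI impI f)
  fix \<U> assume "uniform_covering X d \<U>"
  then obtain r where r: "r > 0" "\<U> \<preceq> {pball X d x r | x. x \<in> X}"
    by (auto simp: uniform_covering_def)
  obtain c where c: "c \<ge> 0" "\<And>x y. x \<in> X \<Longrightarrow> y \<in> X \<Longrightarrow> d (f x) (f y) \<le> c * d x y"
    using L by (auto simp: lipschitz_self_def)
  define s where "s = r / (c + 1)"
  have s: "s > 0" "(c + 1) * s = r"
    using r(1) c(1) by (auto simp: s_def)
  have "{f -` U \<inter> X | U. U \<in> \<U>} \<preceq> {pball X d x s | x. x \<in> X}"
    unfolding refined_by_def
  proof clarify
    fix x assume x: "x \<in> X"
    then have "f x \<in> X" using f by auto
    then obtain U where U: "U \<in> \<U>" "pball X d (f x) r \<subseteq> U"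
      using r(2) by (auto simp: refined_by_def)
    have "pball X d x s \<subseteq> f -` U \<inter> X"
    proof
      fix y assume y: "y \<in> pball X d x s"
      then have yX: "y \<in> X" and ys: "d x y < s" by (auto simp: pball_def)
      have "d (f x) (f y) \<le> c * d x y" using c x yX by auto
      also have "\<dots> \<le> c * s" using c(1) ys by (intro mult_left_mono) auto
      also have "\<dots> < r" using s by (simp add: algebra_simps)
      finally show "y \<in> f -` U \<inter> X" using U f yX by (auto simp: pball_def)
    qed
    then show "\<exists>V\<in>{f -` U \<inter> X | U. U \<in> \<U>}. pball X d x s \<subseteq> V"
      using U(1) by blast
  qed
  then show "uniform_covering X d {f -` U \<inter> X | U. U \<in> \<U>}"
    using s(1) by (auto simp: uniform_covering_def)
qed

lemma Aut_L_subset_uniform_auts: "Aut_L X d \<subseteq> uniform_auts X d"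
proof
  fix f assume f: "f \<in> Aut_L X d"
  then have b: "bij_betw f X X" by (auto simp: Aut_L_def Bij_def)
  have "f \<in> X \<rightarrow> X" "inv_into X f \<in> X \<rightarrow> X"
    using b bij_betw_inv_into[OF b] by (auto simp: bij_betw_def)
  then show "f \<in> uniform_auts X d"
    using f lipschitz_imp_uniformly_cont by (auto simp: Aut_L_def uniform_auts_def)
qed

lemma lipschitz_self_compose:
  assumes "f \<in> X \<rightarrow> X" "g \<in> X \<rightarrow> X" "lipschitz_self X d f" "lipschitz_self X d g"
  shows "lipschitz_self X d (\<lambda>x. f (g x))"
proof -
  obtain a b where a: "a \<ge> 0" "\<And>x y. x \<in> X \<Longrightarrow> y \<in> X \<Longrightarrow> d (f x) (f y) \<le> a * d x y"
    and b: "b \<ge> 0" "\<And>x y. x \<in> X \<Longrightarrow> y \<in> X \<Longrightarrow> d (g x) (g y) \<le> b * d x y"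
    using assms(3,4) by (auto simp: lipschitz_self_def)
  have "d (f (g x)) (f (g y)) \<le> (a * b) * d x y" if "x \<in> X" "y \<in> X" for x y
  proof -
    have "d (f (g x)) (f (g y)) \<le> a * d (g x) (g y)" using a that assms(2) by auto
    also have "\<dots> \<le> a * (b * d x y)" using a(1) b(2) that by (intro mult_left_mono) auto
    finally show ?thesis by simp
  qed
  then show ?thesis using a(1) b(1) by (auto simp: lipschitz_self_def intro!: exI[of _ "a * b"])
qed

lemma lipschitz_self_cong:
  assumes "\<And>x. x \<in> X \<Longrightarrow> f x = g x"
  shows "lipschitz_self X d f \<longleftrightarrow> lipschitz_self X d g"
  using assms by (simp add: lipschitz_self_def)

lemma subgroup_Aut_L: "subgroup (Aut_L X d) (BijGroup X)"
proof
  show "Aut_L X d \<subseteq> carrier (BijGroup X)" by (auto simp: Aut_L_def BijGroup_def)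
next
  fix f g assume fg: "f \<in> Aut_L X d" "g \<in> Aut_L X d"
  then have B: "f \<in> Bij X" "g \<in> Bij X" and b: "bij_betw f X X" "bij_betw g X X"
    by (auto simp: Aut_L_def Bij_def)
  have maps: "f \<in> X \<rightarrow> X" "g \<in> X \<rightarrow> X" "inv_into X f \<in> X \<rightarrow> X" "inv_into X g \<in> X \<rightarrow> X"
    using b bij_betw_inv_into[OF b(1)] bij_betw_inv_into[OF b(2)] by (auto simp: bij_betw_def)
  have c: "compose X f g \<in> Bij X" using B by (rule compose_Bij)
  have inv: "inv_into X (compose X f g) x = inv_into X g (inv_into X f x)" if "x \<in> X" for x
  proof (rule inv_into_f_eq)
    show "inj_on (compose X f g) X" using c by (auto simp: Bij_def bij_betw_def)
    show "inv_into X g (inv_into X f x) \<in> X" using that maps by auto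
    then show "compose X f g (inv_into X g (inv_into X f x)) = x"
      using that maps bij_betw_inv_into_right[OF b(1)] bij_betw_inv_into_right[OF b(2)]
      by (auto simp: compose_def Pi_iff)
  qed
  have "lipschitz_self X d (compose X f g)"
    using lipschitz_self_compose[of f g] fg maps
    by (subst lipschitz_self_cong[of _ "\<lambda>x. f (g x)"]) (auto simp: compose_def Aut_L_def)
  moreover have "lipschitz_self X d (inv_into X (compose X f g))"
    using lipschitz_self_compose[of "inv_into X g" "inv_into X f"] fg maps inv
    by (subst lipschitz_self_cong[of _ "\<lambda>x. inv_into X g (inv_into X f x)"]) (auto simp: Aut_L_def)
  ultimately show "f \<otimes>\<^bsub>BijGroup X\<^esub> g \<in> Aut_L X d"
    using c B by (simp add: Aut_L_def BijGroup_def)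
next
  have id: "lipschitz_self X d (\<lambda>x. x)" by (auto simp: lipschitz_self_def intro!: exI[of _ 1])
  have B: "(\<lambda>x\<in>X. x) \<in> Bij X" by (rule id_Bij)
  have "inv_into X (\<lambda>x\<in>X. x) x = x" if "x \<in> X" for x
    using that by (intro inv_into_f_eq) (auto simp: inj_on_def)
  then show "\<one>\<^bsub>BijGroup X\<^esub> \<in> Aut_L X d"
    using id B lipschitz_self_cong[of "\<lambda>x\<in>X. x" "\<lambda>x. x"]
      lipschitz_self_cong[of "inv_into X (\<lambda>x\<in>X. x)" "\<lambda>x. x"]
    by (auto simp: Aut_L_def BijGroup_def)
next
  fix f assume f: "f \<in> Aut_L X d"
  then have B: "f \<in> Bij X" and b: "bij_betw f X X" by (auto simp: Aut_L_def Bij_def)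
  let ?h = "\<lambda>x\<in>X. inv_into X f x"
  have h: "?h \<in> Bij X" using B by (rule restrict_inv_into_Bij)
  have "inv_into X ?h x = f x" if "x \<in> X" for x
  proof (rule inv_into_f_eq)
    show "inj_on ?h X" using h by (auto simp: Bij_def bij_betw_def)
    show "f x \<in> X" using b that by (auto simp: bij_betw_def)
    then show "?h (f x) = x" using b that by (simp add: bij_betw_def inv_into_f_f)
  qed
  then show "inv\<^bsub>BijGroup X\<^esub> f \<in> Aut_L X d"
    using f h lipschitz_self_cong[of ?h "inv_into X f"] lipschitz_self_cong[of "inv_into X ?h" f]
    by (auto simp: Aut_L_def inv_BijGroup[OF B])
qed

end

end

theory Submission
  imports Defs "HOL-Real_Asymp.Real_Asymp"
begin

text \<open>
  Everything is controlled by \<open>\<nu>(r)\<close>, the least size of a finite uniform covering by sets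
  each contained in some ball of radius \<open>r\<close>. Since \<open>\<nu>(2r)\<close> is at most the covering number
  \<open>\<gamma>(r)\<close>, entropic dimension \<open>0\<close> makes \<open>\<nu>(r)\<close> grow more slowly than every power of \<open>1/r\<close> as
  \<open>r \<rightarrow> 0\<close>. If \<open>\<nu>(r)\<close> exceeded \<open>(1 + e) \<nu>(q r)\<close> at all small scales, it would grow like a positive
  power of \<open>1/r\<close>; so for every factor \<open>q > 1\<close> and every \<open>e > 0\<close> there are arbitrarily small \<open>r\<close>
  with \<open>\<nu>(r) \<le> (1 + e) \<nu>(q r)\<close> (\<open>ex_small_scale_with_slow_growth\<close>). At such a scale a map whose
  Lipschitz constant is absorbed by \<open>q\<close> hardly changes the size of minimal coverings, and both
  assertions follow from this.

  For the complexity, let \<open>\<V>\<close> consist of the \<open>2s\<close>-balls around a finite \<open>s\<close>-net. Then \<open>N(\<V>) \<ge> \<nu>(2s)\<close>, while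
  \<open>\<V> \<or> g(\<V>)\<close> is refined by every family of subsets of \<open>(s/C)\<close>-balls once \<open>C \<ge> 1\<close> is a Lipschitz
  constant of the inverse of \<open>g\<close>. So the ratio in question is at most
  \<open>\<nu>(s/C) / \<nu>(2s) \<le> 1 + e\<close> for suitable \<open>s\<close>. The lower bound \<open>1\<close> comes from the identity map.

  For amenability, let \<open>\<V>\<close> be a minimal covering realising \<open>\<nu>(r)\<close> and let \<open>g\<close> have Lipschitz constant
  \<open>c\<close>. If some members \<open>\<A> \<subseteq> \<V>\<close> are discarded and replaced by those images \<open>g(V)\<close> that meet them, the
  result is still a uniform covering, now by subsets of \<open>(c r)\<close>-balls, so it has at least \<open>\<nu>(c r)\<close>
  members. Hence \<open>\<A>\<close> has at least \<open>|\<A>| - (\<nu>(r) - \<nu>(c r))\<close> neighbours (\<open>card_neighbours_ge\<close>): Hall's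
  condition with a small defect. Applied to the superlevel sets of a uniformly continuous function
  \<open>f\<close>, it shows that the average of \<open>f\<close> over one point from each member of \<open>\<V>\<close> is nearly unchanged
  when \<open>f\<close> is replaced by \<open>f \<circ> g\<close>; summing over levels takes the place of a matching. A single sequence
  of scales works for all \<open>g\<close>, and a pointwise limit of these averages along a filter, which exists
  by Tychonoff's theorem, is an invariant mean.
\<close>

section \<open>Coverings and their complexity\<close>

definition ball_cover :: "'a set \<Rightarrow> ('a \<Rightarrow> 'a \<Rightarrow> real) \<Rightarrow> real \<Rightarrow> 'a set set" where
  "ball_cover X d r = {pball X d x r | x. x \<in> X}"

lemma refined_by_trans: "\<U> \<preceq> \<V> \<Longrightarrow> \<V> \<preceq> \<W> \<Longrightarrow> \<U> \<preceq> \<W>"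
  unfolding refined_by_def by (meson order_trans)

lemma ball_cover_refined_by_smaller:
  assumes "r \<le> s"
  shows "ball_cover X d s \<preceq> ball_cover X d r"
proof -
  have "pball X d x r \<subseteq> pball X d x s" for x using assms by (auto simp: pball_def)
  then show ?thesis unfolding refined_by_def ball_cover_def by blast
qed

lemma refined_by_ball_coverE:
  assumes "\<V> \<preceq> ball_cover X d r" "x \<in> X"
  obtains V where "V \<in> \<V>" "pball X d x r \<subseteq> V"
  using assms unfolding refined_by_def ball_cover_def by blast

lemma ball_cover_refined_byE:
  assumes "ball_cover X d r \<preceq> \<V>" "V \<in> \<V>"
  obtains x where "x \<in> X" "V \<subseteq> pball X d x r"
  using assms unfolding refined_by_def ball_cover_def by blast

lemma cover_N_le:
  "\<V> \<in> fin_uniform_coverings X d \<Longrightarrow> \<U> \<preceq> \<V> \<Longrightarrow> cover_N X d \<U> \<le> card \<V>"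
  unfolding cover_N_def by (rule cInf_lower) auto

lemma cover_N_attained:
  assumes "\<W> \<in> fin_uniform_coverings X d" "\<U> \<preceq> \<W>"
  obtains \<V> where "\<V> \<in> fin_uniform_coverings X d" "\<U> \<preceq> \<V>" "card \<V> = cover_N X d \<U>"
proof -
  have "cover_N X d \<U> \<in> {card \<V> | \<V>. \<V> \<in> fin_uniform_coverings X d \<and> \<U> \<preceq> \<V>}"
    unfolding cover_N_def by (rule Inf_nat_def1) (use assms in auto)
  with that show ?thesis by auto
qed

lemma cover_N_mono:
  assumes "\<W> \<in> fin_uniform_coverings X d" "\<V> \<preceq> \<W>" "\<U> \<preceq> \<V>"
  shows "cover_N X d \<U> \<le> cover_N X d \<V>"
  using cover_N_attained[OF assms(1,2)] cover_N_le refined_by_trans[OF assms(3)] by metis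

section \<open>Comparing sums through superlevel sets\<close>

text \<open>Counting the levels below \<open>a\<close> on a grid of mesh \<open>\<eta>\<close> recovers \<open>a\<close> up to \<open>\<eta>\<close>, as long as the grid
reaches up to \<open>a\<close>: a discrete layer-cake formula.\<close>

lemma step_function_bounds:
  fixes a \<eta> :: real
  assumes "0 < \<eta>" "0 \<le> a"
  shows "min a (real n * \<eta>) \<le> \<eta> * (\<Sum>i<n. of_bool (real i * \<eta> < a))"
    and "\<eta> * (\<Sum>i<n. of_bool (real i * \<eta> < a)) \<le> a + \<eta>"
proof -
  define S where "S n = \<eta> * (\<Sum>i<n. of_bool (real i * \<eta> < a))" for n :: nat
  have S: "S 0 = 0" "S (Suc n) = S n + \<eta> * of_bool (real n * \<eta> < a)" for n
    by (simp_all add: S_def distrib_left del: sum_of_bool_eq)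
  \<comment> \<open>The bound by \<open>n \<eta>\<close> from above is what carries the upper estimate past level \<open>n\<close>.\<close>
  have "min a (real n * \<eta>) \<le> S n \<and> S n \<le> min (a + \<eta>) (real n * \<eta>)"
    by (induction n) (use assms in \<open>auto simp: S algebra_simps min_def split: if_splits\<close>)
  then show "min a (real n * \<eta>) \<le> \<eta> * (\<Sum>i<n. of_bool (real i * \<eta> < a))"
    and "\<eta> * (\<Sum>i<n. of_bool (real i * \<eta> < a)) \<le> a + \<eta>"
    unfolding S_def by simp_all
qed

text \<open>Summing the hypothesis over the \<open>n\<close> levels \<open>i \<eta>\<close>, with weight \<open>\<eta>\<close>, gives the two sums by the
layer-cake formula. The defect \<open>k\<close> is paid once per level; discretising \<open>b + \<eta>\<close>
costs another \<open>\<eta>\<close> per element.\<close>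

lemma sum_le_if_superlevel_card_le:
  fixes a b :: "'b \<Rightarrow> real"
  assumes "finite S" "0 < \<eta>"
    and a: "\<And>s. s \<in> S \<Longrightarrow> 0 \<le> a s \<and> a s \<le> real n * \<eta>"
    and b: "\<And>s. s \<in> S \<Longrightarrow> 0 \<le> b s"
    and level: "\<And>t. real (card {s \<in> S. t < a s}) \<le> real (card {s \<in> S. t < b s + \<eta>}) + k"
  shows "sum a S \<le> sum b S + 2 * \<eta> * real (card S) + real n * \<eta> * k"
proof -
  have count: "real (card {s \<in> S. P s}) = (\<Sum>s\<in>S. of_bool (P s))" for P
    using assms(1) by (simp add: Int_def)
  have "sum a S \<le> (\<Sum>s\<in>S. \<eta> * (\<Sum>i<n. of_bool (real i * \<eta> < a s)))"
    using step_function_bounds(1)[OF assms(2)] a by (intro sum_mono) (metis min.absorb1)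
  also have "\<dots> = \<eta> * (\<Sum>i<n. real (card {s \<in> S. real i * \<eta> < a s}))"
    by (simp only: count sum.swap[of _ S] flip: sum_distrib_left)
  also have "\<dots> \<le> \<eta> * (\<Sum>i<n. real (card {s \<in> S. real i * \<eta> < b s + \<eta>}) + k)"
    using assms(2) level by (intro mult_left_mono sum_mono) auto
  also have "\<dots> = (\<Sum>s\<in>S. \<eta> * (\<Sum>i<n. of_bool (real i * \<eta> < b s + \<eta>))) + real n * \<eta> * k"
    by (simp add: count sum.distrib distrib_left sum.swap[of _ S] flip: sum_distrib_left)
  also have "(\<Sum>s\<in>S. \<eta> * (\<Sum>i<n. of_bool (real i * \<eta> < b s + \<eta>))) \<le> (\<Sum>s\<in>S. b s + \<eta> + \<eta>)"
    using b assms(2) by (intro sum_mono step_function_bounds(2)) (auto intro: add_nonneg_nonneg)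
  also have "\<dots> = sum b S + 2 * \<eta> * real (card S)"
    by (simp add: sum.distrib)
  finally show ?thesis by simp
qed

section \<open>Limits of pointwise bounded functionals\<close>

text \<open>
  By Tychonoff's theorem the sequence \<open>m\<close> lives in a compact product of intervals, so it has a
  cluster point \<open>L\<close>; the filter generated by the tails and by the preimages of the neighbourhoods of
  \<open>L\<close> is then proper. Convergence along one filter makes algebraic identities and inequalities
  between the values of \<open>m\<close> pass to \<open>L\<close>.
\<close>

lemma ex_filter_pointwise_convergent:
  fixes m :: "nat \<Rightarrow> 'b \<Rightarrow> real"
  assumes "\<And>f. \<exists>K. \<forall>j. \<bar>m j f\<bar> \<le> K"
  obtains F L where "F \<noteq> bot" "F \<le> sequentially" "\<And>f. ((\<lambda>j. m j f) \<longlongrightarrow> L f) F"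
proof -
  obtain K where K: "\<And>f j. \<bar>m j f\<bar> \<le> K f" using assms by metis
  define C where "C = (\<Pi>\<^sub>E f\<in>UNIV. {- K f..K f})"
  have "compactin (product_topology (\<lambda>_. euclidean) UNIV) C"
    unfolding C_def by (subst compactin_PiE) (auto simp: compactin_euclidean_iff)
  then have "compact C"
    by (simp add: euclidean_product_topology compactin_euclidean_iff)
  moreover have "eventually (\<lambda>x. x \<in> C) (filtermap m sequentially)"
  proof -
    have "m j f \<in> {- K f..K f}" for j f using K[of j f] by (simp add: abs_le_iff)
    then have "m j \<in> C" for j by (simp add: C_def PiE_UNIV_domain)
    then show ?thesis by (simp add: eventually_filtermap)
  qed
  ultimately obtain L where L: "inf (nhds L) (filtermap m sequentially) \<noteq> bot"
    unfolding compact_filter by (metis filtermap_bot_iff sequentially_bot)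
  define F where "F = inf sequentially (filtercomap m (nhds L))"
  have "F \<noteq> bot"
  proof
    assume "F = bot"
    then obtain P Q where "eventually P sequentially" "eventually Q (nhds L)"
      "\<And>j. P j \<Longrightarrow> \<not> Q (m j)"
      unfolding F_def trivial_limit_def eventually_inf eventually_filtercomap by metis
    then have "eventually (\<lambda>y. \<not> Q y) (filtermap m sequentially)" "eventually Q (nhds L)"
      by (auto simp: eventually_filtermap elim: eventually_mono)
    then have "eventually (\<lambda>_. False) (inf (nhds L) (filtermap m sequentially))"
      unfolding eventually_inf by metis
    with L show False by (simp add: trivial_limit_def)
  qed
  moreover have "((\<lambda>j. m j f) \<longlongrightarrow> L f) F" for f
  proof -
    have "filterlim m (nhds L) F"
      unfolding F_def filterlim_iff_le_filtercomap by simp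
    moreover have "((\<lambda>\<mu>. \<mu> f) \<longlongrightarrow> L f) (nhds L)"
    proof (rule topological_tendstoI)
      fix S :: "real set" assume S: "open S" "L f \<in> S"
      have "open ((\<lambda>\<mu>. \<mu> f) -` S)"
        using S(1) continuous_on_product_coordinates by (rule open_vimage)
      with S(2) show "eventually (\<lambda>\<mu>. \<mu> f \<in> S) (nhds L)"
        by (auto simp: eventually_nhds intro!: exI[of _ "(\<lambda>\<mu>. \<mu> f) -` S"])
    qed
    ultimately show ?thesis by (rule filterlim_compose[rotated])
  qed
  ultimately show ?thesis using that[of F L] by (simp add: F_def)
qed

section \<open>Balls, nets and moduli of continuity\<close>

context pseudo_metric_space
begin

lemma center_in_pball: "x \<in> X \<Longrightarrow> 0 < r \<Longrightarrow> x \<in> pball X d x r"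
  by (simp add: pball_def refl_zero)

lemma pball_subset_pball:
  assumes "x \<in> X" "y \<in> X" "d x y + r \<le> s"
  shows "pball X d y r \<subseteq> pball X d x s"
  using triangle[OF assms(1,2)] assms(3) unfolding pball_def by force

lemma image_pball_subset:
  assumes "g \<in> X \<rightarrow> X" "\<And>x y. x \<in> X \<Longrightarrow> y \<in> X \<Longrightarrow> d (g x) (g y) \<le> c * d x y"
    and "0 < c" "x \<in> X"
  shows "g ` pball X d x r \<subseteq> pball X d (g x) (c * r)"
proof -
  have "d (g x) (g y) < c * r" if "y \<in> X" "d x y < r" for y
    using assms(2)[OF assms(4) that(1)] mult_strict_left_mono[OF that(2) assms(3)] by simp
  with assms(1) show ?thesis by (auto simp: pball_def)
qed

lemma uniform_covering_covers:
  assumes "uniform_covering X d \<U>" "x \<in> X"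
  obtains U where "U \<in> \<U>" "x \<in> U"
proof -
  obtain r where "r > 0" "\<U> \<preceq> {pball X d x r | x. x \<in> X}"
    using assms(1) by (auto simp: uniform_covering_def)
  then obtain U where "U \<in> \<U>" "pball X d x r \<subseteq> U"
    using assms(2) by (auto simp: refined_by_def)
  with center_in_pball[OF assms(2) \<open>r > 0\<close>] that show ?thesis by auto
qed

lemma cover_N_pos:
  assumes "\<W> \<in> fin_uniform_coverings X d" "\<U> \<preceq> \<W>"
  shows "0 < cover_N X d \<U>"
proof -
  obtain \<V> where V: "\<V> \<in> fin_uniform_coverings X d" "card \<V> = cover_N X d \<U>"
    using cover_N_attained[OF assms] by metis
  obtain x where "x \<in> X" using nonempty by auto
  then have "\<V> \<noteq> {}" using V uniform_covering_covers[of \<V> x]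
    by (auto simp: fin_uniform_coverings_def)
  with V show ?thesis by (auto simp: fin_uniform_coverings_def card_gt_0_iff)
qed

text \<open>Doubling the radius turns a covering by balls into a uniform one: a ball of radius \<open>r\<close> around any
point lies in the ball of radius \<open>2 r\<close> around a net point within distance \<open>r\<close>.\<close>

lemma balls_around_net_uniform:
  assumes "F \<subseteq> X" "finite F" "X = (\<Union>x\<in>F. pball X d x r)" "0 < r"
  shows "(\<lambda>x. pball X d x (2 * r)) ` F \<in> fin_uniform_coverings X d"
    and "ball_cover X d (2 * r) \<preceq> (\<lambda>x. pball X d x (2 * r)) ` F"
    and "(\<lambda>x. pball X d x (2 * r)) ` F \<preceq> ball_cover X d r"
proof -
  show "(\<lambda>x. pball X d x (2 * r)) ` F \<preceq> ball_cover X d r"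
    unfolding refined_by_def ball_cover_def
  proof clarify
    fix y assume y: "y \<in> X"
    then obtain x where x: "x \<in> F" "d x y < r" using assms(3) by (auto simp: pball_def)
    then have "pball X d y r \<subseteq> pball X d x (2 * r)"
      using assms(1) y by (intro pball_subset_pball) auto
    with x show "\<exists>U\<in>(\<lambda>x. pball X d x (2 * r)) ` F. pball X d y r \<subseteq> U" by auto
  qed
  then show "(\<lambda>x. pball X d x (2 * r)) ` F \<in> fin_uniform_coverings X d"
    using assms(2,4) unfolding fin_uniform_coverings_def uniform_covering_def ball_cover_def
    by (intro CollectI conjI exI[of _ r] finite_imageI) (auto simp: pball_def)
  show "ball_cover X d (2 * r) \<preceq> (\<lambda>x. pball X d x (2 * r)) ` F"
    using assms(1) by (auto simp: refined_by_def ball_cover_def)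
qed

lemma UC_b_modulus:
  assumes "f \<in> UC_b X d" "0 < \<eta>"
  obtains \<delta> where "0 < \<delta>" "\<And>x y. x \<in> X \<Longrightarrow> y \<in> X \<Longrightarrow> d x y < \<delta> \<Longrightarrow> \<bar>f x - f y\<bar> < \<eta>"
proof -
  let ?U = "{ball u (\<eta> / 2) | u :: real. True}"
  have "pball UNIV dist u (\<eta> / 2) = ball u (\<eta> / 2)" for u :: real
    by (auto simp: pball_def)
  then have "?U \<preceq> {pball UNIV dist u (\<eta> / 2) | u. u \<in> UNIV}"
    unfolding refined_by_def by blast
  then have "uniform_covering UNIV dist ?U"
    using half_gt_zero[OF assms(2)] unfolding uniform_covering_def by blast
  then have "uniform_covering X d {f -` U \<inter> X | U. U \<in> ?U}"
    using assms(1) unfolding UC_b_def uniformly_cont_def by blast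
  then obtain \<delta> where \<delta>: "\<delta> > 0" "{f -` U \<inter> X | U. U \<in> ?U} \<preceq> {pball X d x \<delta> | x. x \<in> X}"
    unfolding uniform_covering_def by blast
  show ?thesis
  proof (rule that[OF \<delta>(1)])
    fix x y assume xy: "x \<in> X" "y \<in> X" "d x y < \<delta>"
    then obtain u where "pball X d x \<delta> \<subseteq> f -` ball u (\<eta> / 2) \<inter> X"
      using \<delta>(2) unfolding refined_by_def by blast
    moreover have "x \<in> pball X d x \<delta>" "y \<in> pball X d x \<delta>"
      using xy \<delta>(1) by (auto simp: pball_def refl_zero)
    ultimately have "dist u (f x) < \<eta> / 2" "dist u (f y) < \<eta> / 2" by auto
    then show "\<bar>f x - f y\<bar> < \<eta>"
      using dist_triangle_half_r by (metis dist_real_def)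
  qed
qed

lemma Aut_L_bij: "g \<in> Aut_L X d \<Longrightarrow> bij_betw g X X"
  by (simp add: Aut_L_def Bij_def)

text \<open>Constants at least \<open>1\<close> are positive and let the estimates for a set and for its image be compared at
a single radius.\<close>

lemma lipschitz_constant_ge_1:
  assumes "lipschitz_self X d f"
  obtains c where "1 \<le> c" "\<And>x y. x \<in> X \<Longrightarrow> y \<in> X \<Longrightarrow> d (f x) (f y) \<le> c * d x y"
proof -
  obtain c where c: "\<And>x y. x \<in> X \<Longrightarrow> y \<in> X \<Longrightarrow> d (f x) (f y) \<le> c * d x y"
    using assms by (auto simp: lipschitz_self_def)
  have "d (f x) (f y) \<le> max 1 c * d x y" if "x \<in> X" "y \<in> X" for x y
    using c[OF that] mult_right_mono[of c "max 1 c" "d x y"] nonneg[OF that] by simp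
  then show ?thesis using that[of "max 1 c"] by simp
qed

end

section \<open>Growth of minimal coverings at small scales\<close>

locale precompact_pseudo_metric_space = pseudo_metric_space +
  assumes precompact: "precompact X d"
begin

abbreviation \<nu> :: "real \<Rightarrow> nat" where
  "\<nu> r \<equiv> cover_N X d (ball_cover X d r)"

lemma ex_fin_covering_by_small_sets:
  assumes "0 < r"
  obtains \<V> where "\<V> \<in> fin_uniform_coverings X d" "ball_cover X d r \<preceq> \<V>"
proof -
  have "uniform_covering X d (ball_cover X d r)"
    using assms unfolding uniform_covering_def ball_cover_def refined_by_def
    by (intro conjI exI[of _ r]) (auto simp: pball_def)
  with precompact that show ?thesis unfolding precompact_def by blast
qed

lemma minimal_covering_by_small_sets:
  assumes "0 < r"
  obtains \<V> where "\<V> \<in> fin_uniform_coverings X d" "ball_cover X d r \<preceq> \<V>" "card \<V> = \<nu> r"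
  using ex_fin_covering_by_small_sets[OF assms] cover_N_attained by metis

lemma \<nu>_pos: "0 < r \<Longrightarrow> 0 < \<nu> r"
  using ex_fin_covering_by_small_sets cover_N_pos by metis

lemma \<nu>_antimono:
  assumes "0 < r" "r \<le> s"
  shows "\<nu> s \<le> \<nu> r"
  using ex_fin_covering_by_small_sets[OF assms(1)] cover_N_mono
    ball_cover_refined_by_smaller[OF assms(2)] by metis

lemma ex_minimal_net:
  assumes "0 < r"
  obtains F where "F \<subseteq> X" "finite F" "X = (\<Union>x\<in>F. pball X d x r)" "card F = covering_number X d r"
proof -
  obtain \<V> where V: "\<V> \<in> fin_uniform_coverings X d" "ball_cover X d r \<preceq> \<V>"
    using ex_fin_covering_by_small_sets[OF assms] .
  then obtain p where p: "\<And>V. V \<in> \<V> \<Longrightarrow> p V \<in> X \<and> V \<subseteq> pball X d (p V) r"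
    unfolding refined_by_def ball_cover_def by simp metis
  have "X \<subseteq> (\<Union>x\<in>p ` \<V>. pball X d x r)"
  proof
    fix x assume "x \<in> X"
    then obtain V where "V \<in> \<V>" "x \<in> V"
      using V(1) uniform_covering_covers by (auto simp: fin_uniform_coverings_def)
    with p show "x \<in> (\<Union>x\<in>p ` \<V>. pball X d x r)" by auto
  qed
  moreover have "(\<Union>x\<in>p ` \<V>. pball X d x r) \<subseteq> X" by (auto simp: pball_def)
  moreover have "p ` \<V> \<in> Fpow X"
    using p V(1) by (auto simp: Fpow_def fin_uniform_coverings_def)
  ultimately have "{card F | F. F \<in> Fpow X \<and> X = (\<Union>x\<in>F. pball X d x r)} \<noteq> {}"
    by blast
  from Inf_nat_def1[OF this] show ?thesis
    using that unfolding covering_number_def Fpow_def by auto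
qed

lemma \<nu>_le_covering_number:
  assumes "0 < r"
  shows "\<nu> (2 * r) \<le> covering_number X d r"
proof -
  obtain F where F: "F \<subseteq> X" "finite F" "X = (\<Union>x\<in>F. pball X d x r)" "card F = covering_number X d r"
    using ex_minimal_net[OF assms] .
  have "\<nu> (2 * r) \<le> card ((\<lambda>x. pball X d x (2 * r)) ` F)"
    using balls_around_net_uniform[OF F(1-3) assms] by (intro cover_N_le)
  also have "\<dots> \<le> card F" using F(2) by (rule card_image_le)
  finally show ?thesis using F(4) by simp
qed

text \<open>Vanishing entropic dimension in the form \<open>\<nu>(2 r) \<le> (1/r)\<^sup>a\<close> for every \<open>a > 0\<close> and all small \<open>r\<close>.\<close>

lemma eventually_log_\<nu>_le:
  assumes "entropic_dim X d = 0" "0 < a"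
  shows "eventually (\<lambda>r. ln (\<nu> (2 * r)) \<le> - a * ln r) (at_right 0)"
proof -
  have "eventually (\<lambda>r. ereal (- (log 2 (real (covering_number X d r)) / log 2 r)) < ereal a)
    (at_right 0)"
    using assms unfolding entropic_dim_def by (intro Limsup_lessD) auto
  moreover have "eventually (\<lambda>r::real. r \<in> {0<..<1}) (at_right 0)"
    by (rule eventually_at_right_real) simp
  ultimately show ?thesis
  proof eventually_elim
    case (elim r)
    have "ln (\<nu> (2 * r)) \<le> ln (covering_number X d r)"
      using \<nu>_le_covering_number[of r] \<nu>_pos[of "2 * r"] elim by simp
    moreover have "- (ln (covering_number X d r) / ln r) < a"
      using elim by (simp add: log_def)
    then have "ln (covering_number X d r) < - a * ln r"
      using elim ln_less_zero[of r] by (simp add: field_simps)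
    ultimately show ?case by simp
  qed
qed

text \<open>If the conclusion failed at all scales \<open>\<rho> / q\<^sup>n\<close>, then \<open>\<nu>(\<rho> / q\<^sup>n) \<ge> (1 + e)\<^sup>n\<close>. This is exponential
in \<open>n\<close>, that is, a power of the inverse scale, against vanishing entropic dimension.\<close>

lemma ex_small_scale_with_slow_growth:
  fixes q e \<rho> :: real
  assumes "entropic_dim X d = 0" "1 < q" "0 < e" "0 < \<rho>"
  obtains r where "0 < r" "r \<le> \<rho>" "\<nu> r \<le> (1 + e) * \<nu> (q * r)"
proof (rule ccontr)
  assume "\<not> thesis"
  with that have growth: "(1 + e) * \<nu> (q * r) < \<nu> r" if "0 < r" "r \<le> \<rho>" for r
    using that by force
  define s where "s n = \<rho> / q ^ n" for n
  have s: "0 < s n" "s n \<le> \<rho>" "q * s (Suc n) = s n" for n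
    using assms one_le_power[of q n] by (auto simp: s_def field_simps)
  have "(1 + e) ^ n \<le> \<nu> (s n)" for n
  proof (induction n)
    case 0
    then show ?case using \<nu>_pos[OF s(1)[of 0]] by simp
  next
    case (Suc n)
    have "(1 + e) ^ Suc n \<le> (1 + e) * \<nu> (s n)"
      using mult_left_mono[OF Suc, of "1 + e"] assms(3) by simp
    also have "\<dots> < \<nu> (s (Suc n))" using growth[OF s(1,2)[of "Suc n"]] s(3) by simp
    finally show ?case by simp
  qed
  then have "ln ((1 + e) ^ n) \<le> ln (\<nu> (s n))" for n
    using assms(3) by (intro ln_mono) auto
  then have lower: "n * ln (1 + e) \<le> ln (\<nu> (s n))" for n
    using assms(3) by (simp add: ln_realpow)
  \<comment> \<open>The exponent is half of the one forced by the failure: \<open>q\<^sup>a\<close> is the square root of \<open>1 + e\<close>.\<close>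
  define a where "a = ln (1 + e) / (2 * ln q)"
  have a: "0 < a" "a * ln q = ln (1 + e) / 2" using assms by (auto simp: a_def)
  have "s \<longlonglongrightarrow> 0"
    unfolding s_def using LIMSEQ_divide_realpow_zero[OF assms(2)] .
  then have "(\<lambda>n. s n / 2) \<longlonglongrightarrow> 0" using tendsto_divide[of s 0 _ "\<lambda>_. 2" 2] by simp
  then have "filterlim (\<lambda>n. s n / 2) (at_right 0) sequentially"
    using s(1) by (intro tendsto_imp_filterlim_at_right) auto
  from eventually_compose_filterlim[OF eventually_log_\<nu>_le[OF assms(1) a(1)] this]
  have "eventually (\<lambda>n. real n * (ln (1 + e) / 2) \<le> - a * (ln \<rho> - ln 2)) sequentially"
  proof eventually_elim
    case (elim n)
    have "ln (s n / 2) = ln \<rho> - n * ln q - ln 2"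
      using assms(2,4) by (simp add: s_def ln_div ln_mult ln_realpow)
    with elim have "ln (\<nu> (s n)) \<le> - a * (ln \<rho> - ln 2) + n * (a * ln q)"
      by (simp add: algebra_simps)
    moreover have "n * (a * ln q) = n * (ln (1 + e) / 2)" using a(2) by simp
    moreover have "n * ln (1 + e) = 2 * (n * (ln (1 + e) / 2))" by simp
    ultimately show ?case using lower[of n] by linarith
  qed
  then obtain M where M: "\<And>n. M \<le> n \<Longrightarrow> real n * (ln (1 + e) / 2) \<le> - a * (ln \<rho> - ln 2)"
    unfolding eventually_sequentially by blast
  have "0 < ln (1 + e) / 2" using assms(3) by simp
  then obtain n where "- a * (ln \<rho> - ln 2) < real n * (ln (1 + e) / 2)"
    using reals_Archimedean3 by blast
  also have "\<dots> \<le> real (max M n) * (ln (1 + e) / 2)"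
    using assms(3) by (intro mult_right_mono) auto
  also have "\<dots> \<le> - a * (ln \<rho> - ln 2)" by (rule M) simp
  finally show False by simp
qed

section \<open>The asymptotic uniform complexity\<close>

lemma one_le_asym_uniform_complexity:
  "1 \<le> asym_uniform_complexity X d (Aut_L X d)"
proof -
  \<comment> \<open>An empty \<open>E\<close> would only contribute \<open>-\<infinity>\<close>, so a group element is needed.\<close>
  let ?id = "\<lambda>x\<in>X. x"
  have "?id \<in> Aut_L X d"
    using subgroup.one_closed[OF subgroup_Aut_L] by (simp add: BijGroup_def)
  then have E: "{?id} \<in> Fpow (Aut_L X d)" by (simp add: Fpow_def)
  have U: "{X} \<in> fin_uniform_coverings X d"
    by (auto simp: fin_uniform_coverings_def uniform_covering_def refined_by_def pball_def
        intro!: exI[of _ 1])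
  have ratio: "1 \<le> ereal (real (cover_N X d (cover_join \<V> ((`) ?id ` \<V>))) / real (cover_N X d \<V>))"
    if V: "\<V> \<in> fin_uniform_coverings X d" for \<V>
  proof -
    have "\<V> \<subseteq> Pow X" using V by (auto simp: fin_uniform_coverings_def uniform_covering_def)
    then have "?id ` V = V" if "V \<in> \<V>" for V using that by auto
    then have id: "(`) ?id ` \<V> = \<V>" by simp
    have self: "\<V> \<preceq> \<V>" by (auto simp: refined_by_def)
    have "\<V> \<preceq> cover_join \<V> \<V>" unfolding refined_by_def cover_join_def by blast
    moreover have "cover_join \<V> \<V> \<preceq> \<V>" unfolding refined_by_def cover_join_def by blast
    ultimately have "cover_N X d \<V> \<le> cover_N X d (cover_join \<V> \<V>)" using V by (intro cover_N_mono)
    with cover_N_pos[OF V self] show ?thesis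
      by (simp only: id) (simp add: one_ereal_def)
  qed
  have "1 \<le> (INF \<V>\<in>{\<V> \<in> fin_uniform_coverings X d. {X} \<preceq> \<V>}.
          SUP g\<in>{?id}. ereal (real (cover_N X d (cover_join \<V> ((`) g ` \<V>))) / real (cover_N X d \<V>)))"
    by (rule INF_greatest) (use ratio in simp)
  then show ?thesis
    unfolding asym_uniform_complexity_def
    by (intro SUP_upper2[OF E] SUP_upper2[OF U])
qed

text \<open>A ball of radius \<open>s / C\<close> lies in some \<open>V \<in> \<V>\<close>; its preimage under \<open>g\<close> is contained in a ball of
radius \<open>s\<close>, hence in some \<open>V' \<in> \<V>\<close>. So the ball lies in the member \<open>V \<inter> g(V')\<close> of the join.\<close>

lemma cover_N_join_image_le:
  assumes "\<V> \<preceq> ball_cover X d s" "0 < s" "bij_betw g X X" "0 < c" "c \<le> C" "1 \<le> C"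
    and "\<And>x y. x \<in> X \<Longrightarrow> y \<in> X \<Longrightarrow> d (inv_into X g x) (inv_into X g y) \<le> c * d x y"
  shows "cover_N X d (cover_join \<V> ((`) g ` \<V>)) \<le> \<nu> (s / C)"
proof -
  have C: "0 < s / C" "s / C \<le> s" "c * (s / C) \<le> s"
    using assms by (auto simp: field_simps mult_left_mono)
  obtain \<W> where W: "\<W> \<in> fin_uniform_coverings X d" "ball_cover X d (s / C) \<preceq> \<W>"
    "card \<W> = \<nu> (s / C)"
    using minimal_covering_by_small_sets[OF C(1)] .
  have "cover_join \<V> ((`) g ` \<V>) \<preceq> ball_cover X d (s / C)"
    unfolding refined_by_def ball_cover_def
  proof clarify
    fix x assume x: "x \<in> X"
    let ?h = "inv_into X g"
    have h: "?h \<in> X \<rightarrow> X" using bij_betw_inv_into[OF assms(3)] by (auto simp: bij_betw_def)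
    have "pball X d x (s / C) \<subseteq> pball X d x s" using C(2) by (auto simp: pball_def)
    then obtain V where V: "V \<in> \<V>" "pball X d x (s / C) \<subseteq> V"
      using refined_by_ball_coverE[OF assms(1) x] by (metis order_trans)
    have "?h ` pball X d x (s / C) \<subseteq> pball X d (?h x) (c * (s / C))"
      using h assms x by (intro image_pball_subset) auto
    also have "\<dots> \<subseteq> pball X d (?h x) s" using C(3) by (auto simp: pball_def)
    finally obtain V' where V': "V' \<in> \<V>" "?h ` pball X d x (s / C) \<subseteq> V'"
      using refined_by_ball_coverE[OF assms(1), of "?h x"] x h by (metis order_trans funcset_mem)
    have "y \<in> g ` V'" if y: "y \<in> pball X d x (s / C)" for y
    proof -
      have "g (?h y) = y" using y bij_betw_inv_into_right[OF assms(3)] by (simp add: pball_def)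
      with V'(2) y show ?thesis by (metis image_eqI image_subset_iff)
    qed
    then have "pball X d x (s / C) \<subseteq> V \<inter> g ` V'" using V(2) by blast
    moreover have "V \<inter> g ` V' \<in> cover_join \<V> ((`) g ` \<V>)"
      using V(1) V'(1) unfolding cover_join_def by blast
    ultimately show "\<exists>U\<in>cover_join \<V> ((`) g ` \<V>). pball X d x (s / C) \<subseteq> U" by blast
  qed
  from refined_by_trans[OF this W(2)] W(1,3) show ?thesis by (metis cover_N_le)
qed

lemma asym_uniform_complexity_le_one:
  assumes "entropic_dim X d = 0"
  shows "asym_uniform_complexity X d (Aut_L X d) \<le> 1"
  unfolding asym_uniform_complexity_def
proof (rule SUP_least, rule SUP_least, rule ereal_le_epsilon2)
  fix E \<U> and e :: real
  assume E: "E \<in> Fpow (Aut_L X d)" and U: "\<U> \<in> fin_uniform_coverings X d" and e: "0 < e"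
  have "\<exists>c. 1 \<le> c \<and> (\<forall>x\<in>X. \<forall>y\<in>X. d (inv_into X g x) (inv_into X g y) \<le> c * d x y)"
    if "g \<in> E" for g
  proof -
    have "lipschitz_self X d (inv_into X g)" using that E by (auto simp: Fpow_def Aut_L_def)
    from lipschitz_constant_ge_1[OF this] show ?thesis by metis
  qed
  then obtain c where c: "\<And>g. g \<in> E \<Longrightarrow> 1 \<le> c g"
    "\<And>g x y. g \<in> E \<Longrightarrow> x \<in> X \<Longrightarrow> y \<in> X \<Longrightarrow> d (inv_into X g x) (inv_into X g y) \<le> c g * d x y"
    by metis
  have fE: "finite E" using E by (simp add: Fpow_def)
  define C where "C = Max (insert 1 (c ` E))"
  have C: "1 \<le> C" "\<And>g. g \<in> E \<Longrightarrow> c g \<le> C" using fE by (auto simp: C_def)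
  obtain \<rho> where \<rho>: "0 < \<rho>" "\<U> \<preceq> ball_cover X d \<rho>"
    using U by (auto simp: fin_uniform_coverings_def uniform_covering_def ball_cover_def)
  obtain t where t: "0 < t" "t \<le> \<rho> / (2 * C)" "\<nu> t \<le> (1 + e) * \<nu> (2 * C * t)"
    using ex_small_scale_with_slow_growth[OF assms, of "2 * C" e "\<rho> / (2 * C)"] C(1) e \<rho>(1)
    by auto
  \<comment> \<open>The \<open>t\<close>-balls are to refine the join, and \<open>2 s\<close> is the radius of the members of the covering,
    so the quotient \<open>2 C\<close> of these two scales is the growth factor used above.\<close>
  define s where "s = C * t"
  have s: "0 < s" "2 * s \<le> \<rho>" "s / C = t" "2 * s = 2 * C * t"
    using t C(1) by (auto simp: s_def field_simps)
  obtain F where F: "F \<subseteq> X" "finite F" "X = (\<Union>x\<in>F. pball X d x s)"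
    using ex_minimal_net[OF s(1)] by metis
  define \<V> where "\<V> = (\<lambda>x. pball X d x (2 * s)) ` F"
  have V: "\<V> \<in> fin_uniform_coverings X d" "ball_cover X d (2 * s) \<preceq> \<V>" "\<V> \<preceq> ball_cover X d s"
    unfolding \<V>_def using balls_around_net_uniform[OF F s(1)] by auto
  have UV: "\<U> \<preceq> \<V>"
    using \<rho>(2) ball_cover_refined_by_smaller[OF s(2)] V(2) by (metis refined_by_trans)
  have self: "\<V> \<preceq> \<V>" by (auto simp: refined_by_def)
  have "ereal (real (cover_N X d (cover_join \<V> ((`) g ` \<V>))) / real (cover_N X d \<V>)) \<le> 1 + ereal e"
    if g: "g \<in> E" for g
  proof -
    have "g \<in> Aut_L X d" using g E by (auto simp: Fpow_def)
    then have "cover_N X d (cover_join \<V> ((`) g ` \<V>)) \<le> \<nu> (s / C)"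
      using V(3) s(1) C c(2)[OF g] c(1)[OF g] g Aut_L_bij
      by (intro cover_N_join_image_le[where c = "c g"]) auto
    also have "real \<dots> \<le> (1 + e) * \<nu> (2 * s)" using t(3) by (simp only: s(3,4))
    also have "\<dots> \<le> (1 + e) * cover_N X d \<V>"
      using cover_N_mono[OF V(1) self V(2)] e by (intro mult_left_mono) auto
    finally show ?thesis
      using cover_N_pos[OF V(1) self] by (simp add: one_ereal_def field_simps)
  qed
  then have "(SUP g\<in>E. ereal (real (cover_N X d (cover_join \<V> ((`) g ` \<V>))) / real (cover_N X d \<V>)))
    \<le> 1 + ereal e" by (rule SUP_least)
  with V(1) UV show "(INF \<V>\<in>{\<V> \<in> fin_uniform_coverings X d. \<U> \<preceq> \<V>}.
        SUP g\<in>E. ereal (real (cover_N X d (cover_join \<V> ((`) g ` \<V>))) / real (cover_N X d \<V>)))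
      \<le> 1 + ereal e"
    by (intro INF_lower2[of \<V>]) auto
qed

section \<open>Almost invariant averages\<close>

text \<open>
  Replace the members \<open>\<A>\<close> of \<open>\<V>\<close> by the images \<open>g(V)\<close> that meet them. A small ball lies in a member
  of \<open>\<V>\<close> and in an image; if the former belongs to \<open>\<A>\<close>, the latter meets it and has been
  added. So the new family is a uniform covering. Its members lie in balls of radius \<open>c r\<close>, and its
  size is at least \<open>\<nu>(c r)\<close>.
\<close>

lemma card_neighbours_ge:
  assumes V: "\<V> \<in> fin_uniform_coverings X d" "ball_cover X d r \<preceq> \<V>" "card \<V> = \<nu> r"
    and r: "0 < r" and g: "g \<in> Aut_L X d"
    and c: "1 \<le> c" "\<And>x y. x \<in> X \<Longrightarrow> y \<in> X \<Longrightarrow> d (g x) (g y) \<le> c * d x y"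
    and A: "\<A> \<subseteq> \<V>"
  shows "card \<A> + \<nu> (c * r) \<le> card {V \<in> \<V>. \<exists>U\<in>\<A>. U \<inter> g ` V \<noteq> {}} + \<nu> r"
proof -
  let ?n = "{V \<in> \<V>. \<exists>U\<in>\<A>. U \<inter> g ` V \<noteq> {}}"
  define \<C> where "\<C> = (\<V> - \<A>) \<union> (`) g ` ?n"
  have fin: "finite \<V>" and VX: "\<V> \<subseteq> Pow X"
    using V(1) by (auto simp: fin_uniform_coverings_def uniform_covering_def)
  have b: "bij_betw g X X" using Aut_L_bij[OF g] .
  then have gX: "g \<in> X \<rightarrow> X" by (auto simp: bij_betw_def)
  let ?h = "inv_into X g"
  have h: "?h \<in> X \<rightarrow> X" using bij_betw_inv_into[OF b] by (auto simp: bij_betw_def)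
  obtain c' where c': "1 \<le> c'" "\<And>x y. x \<in> X \<Longrightarrow> y \<in> X \<Longrightarrow> d (?h x) (?h y) \<le> c' * d x y"
    using g lipschitz_constant_ge_1 unfolding Aut_L_def by blast
  obtain s where s: "0 < s" "\<V> \<preceq> ball_cover X d s"
    using V(1) by (auto simp: fin_uniform_coverings_def uniform_covering_def ball_cover_def)
  have "\<C> \<preceq> ball_cover X d (s / c')"
    unfolding refined_by_def ball_cover_def
  proof clarify
    fix x assume x: "x \<in> X"
    let ?B = "pball X d x (s / c')"
    have "s / c' \<le> s" using c'(1) s(1) by (simp add: field_simps)
    then have "?B \<subseteq> pball X d x s" by (auto simp: pball_def)
    then obtain V where V: "V \<in> \<V>" "?B \<subseteq> V"
      using refined_by_ball_coverE[OF s(2) x] by (metis order_trans)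
    have "?h ` ?B \<subseteq> pball X d (?h x) (c' * (s / c'))"
      using h c' x by (intro image_pball_subset) auto
    then have "?h ` ?B \<subseteq> pball X d (?h x) s" using c'(1) by simp
    then obtain V' where V': "V' \<in> \<V>" "?h ` ?B \<subseteq> V'"
      using refined_by_ball_coverE[OF s(2), of "?h x"] x h by (metis order_trans funcset_mem)
    have B: "?B \<subseteq> g ` V'"
    proof
      fix y assume y: "y \<in> ?B"
      have "g (?h y) = y" using y bij_betw_inv_into_right[OF b] by (simp add: pball_def)
      with V'(2) y show "y \<in> g ` V'" by (metis image_eqI image_subset_iff)
    qed
    show "\<exists>U\<in>\<C>. ?B \<subseteq> U"
    proof (cases "V \<in> \<A>")
      case True
      have "x \<in> ?B" using x s(1) c'(1) by (intro center_in_pball) auto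
      with V(2) B have "V \<inter> g ` V' \<noteq> {}" by auto
      with True V'(1) have "V' \<in> ?n" by blast
      then have "g ` V' \<in> \<C>" unfolding \<C>_def by blast
      with B show ?thesis by blast
    next
      case False
      with V show ?thesis by (auto simp: \<C>_def)
    qed
  qed
  moreover have "\<C> \<subseteq> Pow X" using VX gX by (fastforce simp: \<C>_def)
  moreover have "finite \<C>" using fin by (simp add: \<C>_def)
  moreover have "0 < s / c'" using s(1) c'(1) by simp
  ultimately have C: "\<C> \<in> fin_uniform_coverings X d"
    unfolding fin_uniform_coverings_def uniform_covering_def ball_cover_def by blast
  have "ball_cover X d (c * r) \<preceq> \<C>"
    unfolding refined_by_def
  proof
    fix W assume "W \<in> \<C>"
    then consider "W \<in> \<V>" | V where "V \<in> \<V>" "W = g ` V" by (auto simp: \<C>_def)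
    then show "\<exists>U\<in>ball_cover X d (c * r). W \<subseteq> U"
    proof cases
      case 1
      then obtain x where x: "x \<in> X" "W \<subseteq> pball X d x r"
        using ball_cover_refined_byE[OF V(2)] by metis
      have "r \<le> c * r" using c(1) r by simp
      then have "pball X d x r \<subseteq> pball X d x (c * r)" by (auto simp: pball_def)
      with x show ?thesis by (auto simp: ball_cover_def)
    next
      case 2
      then obtain x where x: "x \<in> X" "V \<subseteq> pball X d x r"
        using ball_cover_refined_byE[OF V(2)] by metis
      have "g ` V \<subseteq> g ` pball X d x r" using x(2) by blast
      also have "\<dots> \<subseteq> pball X d (g x) (c * r)"
        using gX c x(1) by (intro image_pball_subset) auto
      finally have "W \<subseteq> pball X d (g x) (c * r)" using 2(2) by simp
      moreover have "g x \<in> X" using x(1) gX by auto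
      ultimately show ?thesis unfolding ball_cover_def by blast
    qed
  qed
  with C have "\<nu> (c * r) \<le> card \<C>" by (rule cover_N_le)
  also have "\<dots> \<le> card (\<V> - \<A>) + card ((`) g ` ?n)" unfolding \<C>_def by (rule card_Un_le)
  also have "\<dots> \<le> (card \<V> - card \<A>) + card ?n"
    using fin A by (auto simp: card_Diff_subset finite_subset intro!: card_image_le)
  finally show ?thesis using card_mono[OF fin A] V(3) by simp
qed

text \<open>A covering may contain the empty set; taking an arbitrary point of \<open>X\<close> in that case makes averages
over all members meaningful without discarding it.\<close>

definition pick :: "'a set \<Rightarrow> 'a" where
  "pick V = (if V = {} then SOME x. x \<in> X else SOME x. x \<in> V)"

lemma pick_in: "V \<noteq> {} \<Longrightarrow> pick V \<in> V"
  by (simp add: pick_def some_in_eq)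

lemma pick_in_X: "V \<subseteq> X \<Longrightarrow> pick V \<in> X"
proof (cases "V = {}")
  case True
  then show ?thesis using nonempty by (simp add: pick_def some_in_eq)
next
  case False
  then show "V \<subseteq> X \<Longrightarrow> pick V \<in> X" using pick_in by blast
qed

text \<open>If \<open>U\<close> meets \<open>g(V)\<close>, the points picked from \<open>U\<close> and \<open>V\<close> satisfy \<open>d(p\<^sub>U, g(p\<^sub>V)) < 2 r + 2 c r \<le> 4 c r\<close>, so
\<open>f\<close> differs by less than \<open>\<eta>\<close> there. Thus the neighbours of a superlevel set of \<open>f\<close> lie
in a slightly larger superlevel set of \<open>f \<circ> g\<close>, and the lower bound on their number compares the
sums. The shift by \<open>K\<close> in the proof makes the values nonnegative. Only one inequality is proved:
the reverse one is the same statement for \<open>-f\<close>.\<close>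

lemma sum_pick_le_sum_image:
  assumes V: "\<V> \<in> fin_uniform_coverings X d" "ball_cover X d r \<preceq> \<V>" "card \<V> = \<nu> r"
    and r: "0 < r" and g: "g \<in> Aut_L X d"
    and c: "1 \<le> c" "\<And>x y. x \<in> X \<Longrightarrow> y \<in> X \<Longrightarrow> d (g x) (g y) \<le> c * d x y"
    and \<eta>: "0 < \<eta>"
    and f: "\<And>x y. x \<in> X \<Longrightarrow> y \<in> X \<Longrightarrow> d x y < 4 * c * r \<Longrightarrow> \<bar>f x - f y\<bar> < \<eta>"
    and K: "\<And>x. x \<in> X \<Longrightarrow> \<bar>f x\<bar> \<le> K" "2 * K \<le> real n * \<eta>"
  shows "(\<Sum>V\<in>\<V>. f (pick V)) \<le> (\<Sum>V\<in>\<V>. f (g (pick V))) + 2 * \<eta> * \<nu> r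
    + real n * \<eta> * (real (\<nu> r) - real (\<nu> (c * r)))"
proof -
  have fin: "finite \<V>" and VX: "\<And>V. V \<in> \<V> \<Longrightarrow> V \<subseteq> X"
    using V(1) by (auto simp: fin_uniform_coverings_def uniform_covering_def)
  have gX: "g x \<in> X" if "x \<in> X" for x using Aut_L_bij[OF g] that by (auto simp: bij_betw_def)
  have small: "d x y < 2 * r" if "V \<in> \<V>" "x \<in> V" "y \<in> V" for V x y
  proof -
    obtain z where z: "z \<in> X" "V \<subseteq> pball X d z r"
      using ball_cover_refined_byE[OF V(2) \<open>V \<in> \<V>\<close>] .
    then have "x \<in> X" "y \<in> X" "d z x < r" "d z y < r" using that by (auto simp: pball_def)
    with triangle[of x z y] commute[of x z] z(1) show ?thesis by simp
  qed
  have close: "f (pick U) < f (g (pick V)) + \<eta>"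
    if UV: "U \<in> \<V>" "V \<in> \<V>" "U \<inter> g ` V \<noteq> {}" for U V
  proof -
    obtain v where v: "v \<in> V" "g v \<in> U" using UV(3) by auto
    then have p: "pick U \<in> U" "pick V \<in> V" by (auto intro: pick_in)
    then have X: "pick U \<in> X" "pick V \<in> X" "v \<in> X" using v VX UV by auto
    have "d (g v) (g (pick V)) \<le> c * d v (pick V)" using c(2) X by simp
    also have "\<dots> < c * (2 * r)" using small[OF UV(2) v(1) p(2)] c(1) by simp
    finally have "d (g v) (g (pick V)) < 2 * c * r" by simp
    moreover have "d (pick U) (g v) < 2 * r" using small[OF UV(1) p(1) v(2)] .
    moreover have "2 * r \<le> 2 * c * r" using c(1) r by simp
    ultimately have "d (pick U) (g (pick V)) < 4 * c * r"
      using triangle[of "pick U" "g v" "g (pick V)"] X gX by simp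
    from f[OF _ _ this] X gX show ?thesis by fastforce
  qed
  have "(\<Sum>V\<in>\<V>. f (pick V) + K) \<le> (\<Sum>V\<in>\<V>. f (g (pick V)) + K) + 2 * \<eta> * real (card \<V>)
    + real n * \<eta> * (real (\<nu> r) - real (\<nu> (c * r)))"
  proof (rule sum_le_if_superlevel_card_le[OF fin \<eta>])
    fix V assume "V \<in> \<V>"
    then have X: "pick V \<in> X" "g (pick V) \<in> X" using VX pick_in_X gX by auto
    show "0 \<le> f (pick V) + K \<and> f (pick V) + K \<le> real n * \<eta>" using K(1)[OF X(1)] K(2) by auto
    show "0 \<le> f (g (pick V)) + K" using K(1)[OF X(2)] by auto
  next
    fix t
    let ?A = "{V \<in> \<V>. t < f (pick V) + K}"
    have "card {V \<in> \<V>. \<exists>U\<in>?A. U \<inter> g ` V \<noteq> {}} \<le> card {V \<in> \<V>. t < f (g (pick V)) + K + \<eta>}"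
      using fin close by (intro card_mono) (auto, fastforce)
    moreover have "card ?A + \<nu> (c * r) \<le> card {V \<in> \<V>. \<exists>U\<in>?A. U \<inter> g ` V \<noteq> {}} + \<nu> r"
      using V r g c by (intro card_neighbours_ge) auto
    ultimately show "real (card ?A) \<le> real (card {V \<in> \<V>. t < f (g (pick V)) + K + \<eta>}) +
      (real (\<nu> r) - real (\<nu> (c * r)))" by linarith
  qed
  then show ?thesis by (simp add: sum.distrib V(3))
qed

definition mean :: "'a set set \<Rightarrow> ('a \<Rightarrow> real) \<Rightarrow> real" where
  "mean \<V> f = (\<Sum>V\<in>\<V>. f (pick V)) / card \<V>"

lemma mean_bounds:
  assumes "\<V> \<in> fin_uniform_coverings X d" "\<And>x. x \<in> X \<Longrightarrow> a \<le> f x \<and> f x \<le> b"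
  shows "a \<le> mean \<V> f" "mean \<V> f \<le> b"
proof -
  have fin: "finite \<V>" and VX: "\<And>V. V \<in> \<V> \<Longrightarrow> V \<subseteq> X"
    using assms(1) by (auto simp: fin_uniform_coverings_def uniform_covering_def)
  obtain x where "x \<in> X" using nonempty by auto
  then have "\<V> \<noteq> {}" using assms(1) uniform_covering_covers[of \<V> x]
    by (auto simp: fin_uniform_coverings_def)
  then have pos: "0 < real (card \<V>)" using fin by (simp add: card_gt_0_iff)
  have ab: "a \<le> f (pick V)" "f (pick V) \<le> b" if "V \<in> \<V>" for V
    using assms(2)[OF pick_in_X[OF VX[OF that]]] by auto
  have "(\<Sum>V\<in>\<V>. a) \<le> (\<Sum>V\<in>\<V>. f (pick V))" by (rule sum_mono) (rule ab(1))
  moreover have "(\<Sum>V\<in>\<V>. f (pick V)) \<le> (\<Sum>V\<in>\<V>. b)" by (rule sum_mono) (rule ab(2))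
  ultimately show "a \<le> mean \<V> f" "mean \<V> f \<le> b"
    using pos by (auto simp: mean_def field_simps)
qed

lemma mean_cong:
  assumes "\<V> \<in> fin_uniform_coverings X d" "\<And>x. x \<in> X \<Longrightarrow> f x = h x"
  shows "mean \<V> f = mean \<V> h"
proof -
  have "V \<subseteq> X" if "V \<in> \<V>" for V
    using assms(1) that by (auto simp: fin_uniform_coverings_def uniform_covering_def)
  then show ?thesis unfolding mean_def using assms(2) pick_in_X by (metis (no_types, lifting) sum.cong)
qed

text \<open>At the \<open>j\<close>-th scale the growth factor is \<open>j + 2\<close> and the defect is a \<open>1/(j + 1)\<close> fraction of the
covering. The growth factor eventually exceeds the Lipschitz constant of each \<open>g\<close>, and the number of
levels needed for a given \<open>f\<close> and tolerance does not depend on \<open>j\<close>, so the total defect vanishes in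
the limit.\<close>

lemma ex_almost_invariant_coverings:
  assumes "entropic_dim X d = 0"
  shows "\<exists>\<V>. (\<forall>j::nat. \<V> j \<in> fin_uniform_coverings X d) \<and>
    (\<forall>f\<in>UC_b X d. \<forall>g\<in>Aut_L X d.
       (\<lambda>j. mean (\<V> j) (\<lambda>x. f (g x)) - mean (\<V> j) f) \<longlonglongrightarrow> 0)"
proof -
  have "\<exists>r. 0 < r \<and> r \<le> 1 / (real j + 1) \<and> \<nu> r \<le> (1 + 1 / (real j + 1)) * \<nu> ((real j + 2) * r)"
    for j :: nat
    using ex_small_scale_with_slow_growth[OF assms, of "real j + 2" "1 / (real j + 1)" "1 / (real j + 1)"]
    by (smt (verit) of_nat_0_le_iff zero_less_divide_iff)
  then obtain r where r: "\<And>j. 0 < r j" "\<And>j. r j \<le> 1 / (real j + 1)"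
    "\<And>j. \<nu> (r j) \<le> (1 + 1 / (real j + 1)) * \<nu> ((real j + 2) * r j)" by metis
  have "\<exists>\<V>. \<V> \<in> fin_uniform_coverings X d \<and> ball_cover X d (r j) \<preceq> \<V> \<and> card \<V> = \<nu> (r j)" for j
    using minimal_covering_by_small_sets[OF r(1)] by metis
  then obtain \<V> where V: "\<And>j. \<V> j \<in> fin_uniform_coverings X d"
    "\<And>j. ball_cover X d (r j) \<preceq> \<V> j" "\<And>j. card (\<V> j) = \<nu> (r j)" by metis
  have r0: "r \<longlonglongrightarrow> 0"
  proof (rule tendsto_sandwich[of "\<lambda>_. 0"])
    show "(\<lambda>j. 1 / (real j + 1)) \<longlonglongrightarrow> 0" by real_asymp
  qed (use r in \<open>auto simp: less_imp_le\<close>)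
  show ?thesis
  proof (intro exI[of _ \<V>] conjI allI ballI V(1) tendstoI)
    fix f g and \<epsilon> :: real
    assume f: "f \<in> UC_b X d" and g: "g \<in> Aut_L X d" and \<epsilon>: "0 < \<epsilon>"
    \<comment> \<open>The averages will differ by at most \<open>3 \<eta>\<close>: one \<open>\<eta>\<close> each for the oscillation of \<open>f\<close>, the
      discretisation into levels, and the defect.\<close>
    define \<eta> where "\<eta> = \<epsilon> / 4"
    have \<eta>: "0 < \<eta>" using \<epsilon> by (simp add: \<eta>_def)
    obtain c where c: "1 \<le> c" "\<And>x y. x \<in> X \<Longrightarrow> y \<in> X \<Longrightarrow> d (g x) (g y) \<le> c * d x y"
      using g lipschitz_constant_ge_1 unfolding Aut_L_def by blast
    obtain \<delta> where \<delta>: "0 < \<delta>" "\<And>x y. x \<in> X \<Longrightarrow> y \<in> X \<Longrightarrow> d x y < \<delta> \<Longrightarrow> \<bar>f x - f y\<bar> < \<eta>"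
      using UC_b_modulus[OF f \<eta>] by metis
    obtain K where K: "\<And>x. x \<in> X \<Longrightarrow> \<bar>f x\<bar> \<le> K"
      using f by (auto simp: UC_b_def bounded_iff)
    obtain n where n: "2 * K \<le> real n * \<eta>"
      using reals_Archimedean3[OF \<eta>] less_imp_le by metis
    have "eventually (\<lambda>j. 4 * c * r j < \<delta>) sequentially"
    proof -
      have "(\<lambda>j. 4 * c * r j) \<longlonglongrightarrow> 4 * c * 0" by (intro tendsto_intros r0)
      then show ?thesis using \<delta>(1) by (auto intro: order_tendstoD(2))
    qed
    moreover have "eventually (\<lambda>j. c \<le> real j + 2) sequentially" by real_asymp
    moreover have "eventually (\<lambda>j. real n * \<eta> / (real j + 1) < \<eta>) sequentially"
      by (rule order_tendstoD(2)[OF _ \<eta>]) real_asymp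
    ultimately show "eventually (\<lambda>j. dist (mean (\<V> j) (\<lambda>x. f (g x)) - mean (\<V> j) f) 0 < \<epsilon>) sequentially"
    proof eventually_elim
      case (elim j)
      let ?N = "real (\<nu> (r j))"
      have N: "0 < ?N" using \<nu>_pos[OF r(1)] by simp
      have "\<nu> ((real j + 2) * r j) \<le> \<nu> (c * r j)"
        using c(1) elim r(1)[of j] by (intro \<nu>_antimono mult_right_mono mult_pos_pos) auto
      then have "?N \<le> (1 + 1 / (real j + 1)) * \<nu> (c * r j)"
        by (intro order_trans[OF r(3)] mult_left_mono) auto
      moreover have "1 / (real j + 1) * \<nu> (c * r j) \<le> 1 / (real j + 1) * ?N"
        using \<nu>_antimono[of "r j" "c * r j"] r(1) c(1) by (intro mult_left_mono) auto
      ultimately have "?N - \<nu> (c * r j) \<le> 1 / (real j + 1) * ?N" by (simp add: algebra_simps)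
      then have "real n * \<eta> * (?N - \<nu> (c * r j)) \<le> real n * \<eta> * (1 / (real j + 1) * ?N)"
        using \<eta> by (intro mult_left_mono) auto
      also have "\<dots> \<le> \<eta> * ?N"
        using mult_right_mono[OF less_imp_le[OF elim(3)], of ?N] N by simp
      finally have defect: "real n * \<eta> * (?N - \<nu> (c * r j)) \<le> \<eta> * ?N" .
      have sums: "(\<Sum>V\<in>\<V> j. h (pick V)) \<le> (\<Sum>V\<in>\<V> j. h (g (pick V))) + 3 * \<eta> * ?N"
        if "h = f \<or> h = (\<lambda>x. - f x)" for h
      proof -
        have "(\<Sum>V\<in>\<V> j. h (pick V)) \<le> (\<Sum>V\<in>\<V> j. h (g (pick V))) + 2 * \<eta> * \<nu> (r j)
            + real n * \<eta> * (?N - real (\<nu> (c * r j)))"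
        proof (rule sum_pick_le_sum_image[OF V r(1) g c \<eta> _ _ n])
          fix x y assume "x \<in> X" "y \<in> X" "d x y < 4 * c * r j"
          then show "\<bar>h x - h y\<bar> < \<eta>" using that \<delta>(2)[of x y] elim(1) by auto
        qed (use that K in auto)
        with defect show ?thesis by simp
      qed
      have "\<bar>(\<Sum>V\<in>\<V> j. f (g (pick V))) - (\<Sum>V\<in>\<V> j. f (pick V))\<bar> \<le> 3 * \<eta> * ?N"
        using sums[of f] sums[of "\<lambda>x. - f x"] by (simp add: sum_negf abs_le_iff)
      also have "\<dots> < \<epsilon> * ?N" using N \<epsilon> by (simp add: \<eta>_def)
      finally have "\<bar>(\<Sum>V\<in>\<V> j. f (g (pick V))) - (\<Sum>V\<in>\<V> j. f (pick V))\<bar> < \<epsilon> * ?N" .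
      moreover have "\<bar>mean (\<V> j) (\<lambda>x. f (g x)) - mean (\<V> j) f\<bar> =
          \<bar>(\<Sum>V\<in>\<V> j. f (g (pick V))) - (\<Sum>V\<in>\<V> j. f (pick V))\<bar> / ?N"
        using N by (simp add: mean_def V(3) abs_divide flip: diff_divide_distrib)
      ultimately show ?case using N by (simp add: pos_divide_less_eq)
    qed
  qed
qed

section \<open>The invariant mean\<close>

lemma amenable_Aut_L:
  assumes "entropic_dim X d = 0"
  shows "amenable X d (Aut_L X d)"
proof -
  obtain \<V> where V: "\<And>j::nat. \<V> j \<in> fin_uniform_coverings X d"
    and inv: "\<And>f g. f \<in> UC_b X d \<Longrightarrow> g \<in> Aut_L X d \<Longrightarrow>
       (\<lambda>j. mean (\<V> j) (\<lambda>x. f (g x)) - mean (\<V> j) f) \<longlonglongrightarrow> 0"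
    using ex_almost_invariant_coverings[OF assms] by blast
  \<comment> \<open>The value \<open>0\<close> on unbounded functions only serves to make the functionals pointwise bounded in \<open>j\<close>
    on all functions, so that one product of compact intervals contains them.\<close>
  define m where "m j f = (if bounded (f ` X) then mean (\<V> j) f else 0)" for j f
  have "\<exists>K. \<forall>j. \<bar>m j f\<bar> \<le> K" for f
  proof (cases "bounded (f ` X)")
    case True
    then obtain K where K: "\<And>x. x \<in> X \<Longrightarrow> \<bar>f x\<bar> \<le> K" by (auto simp: bounded_iff)
    have "\<bar>m j f\<bar> \<le> K" for j
      using mean_bounds[OF V[of j], of "- K" f K] K True by (force simp: m_def abs_le_iff)
    then show ?thesis by blast
  qed (auto simp: m_def)
  then obtain F L where F: "F \<noteq> bot" "F \<le> sequentially"
    and L: "\<And>f. ((\<lambda>j. m j f) \<longlongrightarrow> L f) F"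
    using ex_filter_pointwise_convergent[of m] by metis
  have m: "m j f = mean (\<V> j) f" if "bounded (f ` X)" for j f using that by (simp add: m_def)
  have bdd: "bounded (f ` X)" if "f \<in> UC_b X d" for f using that by (simp add: UC_b_def)
  show ?thesis
    unfolding amenable_def
  proof (intro exI[of _ L] conjI ballI allI)
    fix f h assume "f \<in> UC_b X d" "h \<in> UC_b X d"
    then have b: "bounded (f ` X)" "bounded (h ` X)" using bdd by auto
    then have "bounded ((\<lambda>x\<in>X. f x + h x) ` X)"
      using bounded_plus_comp[of f X h] by simp
    then have "m j (\<lambda>x\<in>X. f x + h x) = m j f + m j h" for j
      using b mean_cong[OF V, of "\<lambda>x\<in>X. f x + h x" "\<lambda>x. f x + h x"]
      by (simp add: m) (simp add: mean_def sum.distrib add_divide_distrib)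
    then show "L (\<lambda>x\<in>X. f x + h x) = L f + L h"
      using tendsto_unique[OF F(1) L[of "\<lambda>x\<in>X. f x + h x"]] tendsto_add[OF L L] by simp
  next
    fix c f assume "f \<in> UC_b X d"
    then have b: "bounded (f ` X)" using bdd by auto
    then have "bounded ((\<lambda>x\<in>X. c * f x) ` X)"
      using bounded_scaling[OF b, of c] by (simp add: image_image)
    then have "m j (\<lambda>x\<in>X. c * f x) = c * m j f" for j
      using b mean_cong[OF V, of "\<lambda>x\<in>X. c * f x" "\<lambda>x. c * f x"]
      by (simp add: m) (simp add: mean_def sum_distrib_left)
    then show "L (\<lambda>x\<in>X. c * f x) = c * L f"
      using tendsto_unique[OF F(1) L[of "\<lambda>x\<in>X. c * f x"]] tendsto_mult_left[OF L] by simp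
  next
    fix f assume f: "f \<in> UC_b X d"
    have "(INF x\<in>X. f x) \<le> f x \<and> f x \<le> (SUP x\<in>X. f x)" if "x \<in> X" for x
      using that bdd[OF f] by (auto intro!: cINF_lower cSUP_upper bounded_imp_bdd_below bounded_imp_bdd_above)
    from mean_bounds[OF V this]
    have "(INF x\<in>X. f x) \<le> m j f" "m j f \<le> (SUP x\<in>X. f x)" for j
      using m[OF bdd[OF f]] by auto
    then show "(INF x\<in>X. f x) \<le> L f" "L f \<le> (SUP x\<in>X. f x)"
      using tendsto_lowerbound[OF L _ F(1)] tendsto_upperbound[OF L _ F(1)] by auto
  next
    fix f g assume f: "f \<in> UC_b X d" and g: "g \<in> Aut_L X d"
    have "compose X f g ` X \<subseteq> f ` X"
      using Aut_L_bij[OF g] by (auto simp: compose_def bij_betw_def)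
    then have b: "bounded (compose X f g ` X)" using bdd[OF f] bounded_subset by blast
    have m': "m j (compose X f g) = mean (\<V> j) (\<lambda>x. f (g x))" for j
      unfolding m[OF b] by (rule mean_cong[OF V]) (simp add: compose_def)
    have "((\<lambda>j. m j (compose X f g) - m j f) \<longlongrightarrow> 0) F"
      using tendsto_mono[OF F(2) inv[OF f g]] by (simp add: m' m[OF bdd[OF f]])
    moreover have "((\<lambda>j. m j (compose X f g) - m j f) \<longlongrightarrow> L (compose X f g) - L f) F"
      by (intro tendsto_diff L)
    ultimately have "L (compose X f g) - L f = 0" using tendsto_unique[OF F(1)] by blast
    then show "L (compose X f g) = L f" by simp
  qed
qed

end

theorem theorem8p2:
  fixes X :: "'a set" and d :: "'a \<Rightarrow> 'a \<Rightarrow> real"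
  assumes "pseudo_metric_space X d"
    and "precompact X d"
    and "entropic_dim X d = 0"
  shows "asym_uniform_complexity X d (Aut_L X d) = 1 \<and> amenable X d (Aut_L X d)"
proof -
  interpret precompact_pseudo_metric_space X d
    using assms(1,2) by (simp add: precompact_pseudo_metric_space_def
        precompact_pseudo_metric_space_axioms_def)
  show ?thesis
    using asym_uniform_complexity_le_one[OF assms(3)] one_le_asym_uniform_complexity
      amenable_Aut_L[OF assms(3)] by (simp add: antisym)
qed

end
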